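(* Almost all graphs are not edge transmission irregular (ETI). That is, the proportion of graphs with vertex set $\{1, \dots, n\}$ that are ETI, among all $2^{\binom{n}{2}}$ graphs with this vertex set, tends to $0$ as $n \to \infty$.
   Context: All graphs are finite, simple and undirected. For a connected graph $G$ and $v \in V(G)$, the transmission of $v$ is $\mathrm{Tr}_G(v) = \sum_{u \in V(G)} d_G(v,u)$, where $d_G$ is the shortest-path distance. For an edge $e = uv \in E(G)$, the transmission of $e$ is $\mathrm{Tr}_G(e) = \mathrm{Tr}_G(u) + \mathrm{Tr}_G(v)$. A graph $G$ is edge transmission irregular (ETI) if it is connected and any two distinct edges of $G$ have different transmissions. *)

theory Defs
  imports Complex_Main
begin

(* A graph is given by a vertex set V and a set E of two-element subsets of V. *)

definition simple_graph :: "'a set \<Rightarrow> 'a set set \<Rightarrow> bool" where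
  "simple_graph V E \<longleftrightarrow> finite V \<and> E \<subseteq> {e. e \<subseteq> V \<and> card e = 2}"

(* Edge sets of the labelled graphs with vertex set V (not up to isomorphism). *)

definition graphs_on :: "'a set \<Rightarrow> 'a set set set" where
  "graphs_on V = {E. simple_graph V E}"

lemma card_graphs_on:
  assumes "finite V"
  shows "card (graphs_on V) = 2 ^ (card V choose 2)"
proof -
  have "graphs_on V = Pow {e. e \<subseteq> V \<and> card e = 2}"
    using assms by (auto simp: graphs_on_def simple_graph_def)
  then show ?thesis
    using assms by (simp add: card_Pow n_subsets)
qed

(* A path is the list of its vertices, so its length is one less than that of the list. *)

definition is_path :: "'a set \<Rightarrow> 'a set set \<Rightarrow> 'a \<Rightarrow> 'a list \<Rightarrow> 'a \<Rightarrow> bool" where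
  "is_path V E u p v \<longleftrightarrow>
     p \<noteq> [] \<and> hd p = u \<and> last p = v \<and> set p \<subseteq> V \<and> distinct p \<and>
     successively (\<lambda>x y. {x, y} \<in> E) p"

definition connected_graph :: "'a set \<Rightarrow> 'a set set \<Rightarrow> bool" where
  "connected_graph V E \<longleftrightarrow> (\<forall>u\<in>V. \<forall>v\<in>V. \<exists>p. is_path V E u p v)"

(* Meaningful only when u and v are joined by a path. *)

definition graph_dist :: "'a set \<Rightarrow> 'a set set \<Rightarrow> 'a \<Rightarrow> 'a \<Rightarrow> nat" where
  "graph_dist V E u v = (LEAST k. \<exists>p. is_path V E u p v \<and> length p = Suc k)"

definition transmission :: "'a set \<Rightarrow> 'a set set \<Rightarrow> 'a \<Rightarrow> nat" where
  "transmission V E v = (\<Sum>u\<in>V. graph_dist V E v u)"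

(* For e = {u, v} with u and v distinct this is the sum of the transmissions of u and v. *)

definition edge_transmission :: "'a set \<Rightarrow> 'a set set \<Rightarrow> 'a set \<Rightarrow> nat" where
  "edge_transmission V E e = (\<Sum>v\<in>e. transmission V E v)"

definition edge_transmission_irregular :: "'a set \<Rightarrow> 'a set set \<Rightarrow> bool" where
  "edge_transmission_irregular V E \<longleftrightarrow>
     simple_graph V E \<and> connected_graph V E \<and> inj_on (edge_transmission V E) E"

end

theory Submission
  imports Defs "HOL-Library.Disjoint_Sets" "HOL-Real_Asymp.Real_Asymp"
begin

text \<open>
  Why almost no graph is ETI: if all distances in a graph on \<open>n\<close> vertices are at most \<open>2\<close>, then
  every vertex transmission lies between \<open>n - 1\<close> and \<open>2 * (n - 1)\<close>, so the edge transmissions take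
  at most \<open>2 * n - 1\<close> values. By the pigeonhole principle such a graph is not ETI as soon as it has
  \<open>2 * n\<close> edges.

  Both requirements follow from a single extension property: every set of \<open>4\<close> vertices has a common
  neighbour. It makes any two vertices have a common neighbour, which bounds the distances; and it
  forces every degree to be at least \<open>4\<close>, because a vertex \<open>v\<close> with at most three neighbours would
  have yet another neighbour, namely a common neighbour of \<open>v\<close> and of these. Summing degrees gives
  \<open>2 * n\<close> edges (\<open>extension_property_not_ETI\<close>).

  The extension property holds for almost all graphs by a union bound. For a fixed
  \<open>S\<close> with four elements, the events that a vertex \<open>w\<close> outside \<open>S\<close> is joined to all of \<open>S\<close> concern
  disjoint sets of four pairs for different \<open>w\<close>, so they all fail for a proportion
  \<open>(15/16) ^ (n - 4)\<close> of the graphs (\<open>card_no_common_neighbour\<close>). There are at most \<open>n ^ 4\<close> choices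
  of \<open>S\<close>, and \<open>n ^ 4 * (15/16) ^ (n - 4)\<close> tends to \<open>0\<close>.
\<close>

section \<open>Common neighbours\<close>

definition common_neighbour :: "'a set set \<Rightarrow> 'a set \<Rightarrow> 'a \<Rightarrow> bool" where
  "common_neighbour E S w \<longleftrightarrow> (\<forall>s\<in>S. {w, s} \<in> E)"

definition extension_property :: "nat \<Rightarrow> 'a set \<Rightarrow> 'a set set \<Rightarrow> bool" where
  "extension_property k V E \<longleftrightarrow>
     (\<forall>S. S \<subseteq> V \<and> card S = k \<longrightarrow> (\<exists>w\<in>V - S. common_neighbour E S w))"

lemma extension_property_le:
  assumes "extension_property k V E" "finite V" "k \<le> card V" "S \<subseteq> V" "card S \<le> k"
  shows "\<exists>w\<in>V - S. common_neighbour E S w"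
proof -
  obtain T where T: "S \<subseteq> T" "T \<subseteq> V" "card T = k"
    using exists_subset_between[of S k V] assms by auto
  then obtain w where "w \<in> V - T" "common_neighbour E T w"
    using assms(1) by (auto simp: extension_property_def)
  then show ?thesis
    using T(1) by (auto simp: common_neighbour_def)
qed

section \<open>Distances and transmissions\<close>

lemma graph_dist_le:
  assumes "is_path V E u p v"
  shows "graph_dist V E u v \<le> length p - 1"
  unfolding graph_dist_def
proof (rule Least_le, intro exI conjI)
  show "length p = Suc (length p - 1)"
    using assms by (cases p) (auto simp: is_path_def)
qed (fact assms)

lemma graph_dist_self:
  assumes "v \<in> V"
  shows "graph_dist V E v v = 0"
  using graph_dist_le[of V E v "[v]" v] assms by (simp add: is_path_def)

text \<open>A path has to exist: otherwise the distance is an unspecified number.\<close>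

lemma graph_dist_pos:
  assumes "is_path V E u p v" "u \<noteq> v"
  shows "1 \<le> graph_dist V E u v"
proof -
  have "\<exists>k q. is_path V E u q v \<and> length q = Suc k"
    using assms(1) by (intro exI[of _ "length p - 1"] exI[of _ p]) (cases p; auto simp: is_path_def)
  then have "\<exists>q. is_path V E u q v \<and> length q = Suc (graph_dist V E u v)"
    unfolding graph_dist_def by (rule LeastI_ex)
  then obtain q where q: "is_path V E u q v" "length q = Suc (graph_dist V E u v)"
    by blast
  show ?thesis
  proof (rule ccontr)
    assume "\<not> ?thesis"
    then have "length q = 1"
      using q(2) by simp
    then obtain x where "q = [x]"
      by (auto simp: length_Suc_conv)
    then show False
      using q(1) assms(2) by (auto simp: is_path_def)
  qed
qed

lemma graph_dist_common_neighbour: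
  assumes "u \<in> V" "v \<in> V" "u \<noteq> v" "w \<in> V - {u, v}" "common_neighbour E {u, v} w"
  shows "graph_dist V E u v \<in> {1..2}"
proof -
  have path: "is_path V E u [u, w, v] v"
    using assms by (auto simp: is_path_def common_neighbour_def insert_commute)
  show ?thesis
    using graph_dist_le[OF path] graph_dist_pos[OF path assms(3)] by simp
qed

lemma transmission_bounds:
  assumes "finite V" "v \<in> V" "\<And>u. u \<in> V - {v} \<Longrightarrow> graph_dist V E v u \<in> {1..2}"
  shows "transmission V E v \<in> {card V - 1..2 * (card V - 1)}"
proof -
  have eq: "transmission V E v = (\<Sum>u\<in>V - {v}. graph_dist V E v u)"
    using assms by (simp add: transmission_def sum.remove[of V v] graph_dist_self)
  have "card (V - {v}) * 1 \<le> transmission V E v"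
    unfolding eq using sum_bounded_below[of "V - {v}" 1 "graph_dist V E v"] assms(3) by simp
  moreover have "transmission V E v \<le> card (V - {v}) * 2"
    unfolding eq using sum_bounded_above[of "V - {v}" "graph_dist V E v" 2] assms(3) by simp
  ultimately show ?thesis
    using assms by simp
qed

section \<open>The extension property excludes irregularity\<close>

lemma sum_degrees:
  assumes "simple_graph V E"
  shows "(\<Sum>v\<in>V. card {e \<in> E. v \<in> e}) = 2 * card E"
proof -
  have "E \<subseteq> Pow V" "finite V"
    using assms by (auto simp: simple_graph_def)
  then have "finite E"
    by (meson finite_Pow_iff finite_subset)
  have "{v \<in> V. v \<in> e} = e \<and> card e = 2" if "e \<in> E" for e
    using assms that by (auto simp: simple_graph_def)
  then have "(\<Sum>v\<in>V. card {e \<in> E. v \<in> e}) = (\<Sum>e\<in>E. 2)"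
    using sum_multicount_gen[OF \<open>finite V\<close> \<open>finite E\<close>, of "\<lambda>v e. v \<in> e" "\<lambda>_. 2"] by simp
  then show ?thesis
    by simp
qed

text \<open>
  A vertex \<open>v\<close> with fewer than \<open>k\<close> neighbours is impossible: together with them it forms a set of at
  most \<open>k\<close> vertices, and a common neighbour of this set is a neighbour of \<open>v\<close> that was not counted.
\<close>

lemma extension_property_min_degree:
  assumes graph: "simple_graph V E" and ext: "extension_property k V E"
    and "k \<le> card V" "v \<in> V"
  shows "k \<le> card {e \<in> E. v \<in> e}"
proof (rule ccontr)
  let ?N = "{e \<in> E. v \<in> e}"
  assume "\<not> ?thesis"
  have fin: "finite V"
    using graph by (simp add: simple_graph_def)
  have sub: "E \<subseteq> {e. e \<subseteq> V \<and> card e = 2}"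
    using graph by (simp add: simple_graph_def)
  define S where "S = insert v {x \<in> V. {v, x} \<in> E}"
  have "inj_on (\<lambda>x. {v, x}) {x \<in> V. {v, x} \<in> E}"
    by (auto simp: inj_on_def doubleton_eq_iff)
  moreover have "finite ?N"
    using sub fin by (intro finite_subset[of ?N "Pow V"]) auto
  ultimately have "card {x \<in> V. {v, x} \<in> E} \<le> card ?N"
    by (intro card_inj_on_le[of "\<lambda>x. {v, x}"]) auto
  then have "card S \<le> k"
    using \<open>\<not> k \<le> card ?N\<close> card_insert_le_m1[of k "{x \<in> V. {v, x} \<in> E}" v]
    by (simp add: S_def)
  moreover have "S \<subseteq> V"
    using \<open>v \<in> V\<close> by (auto simp: S_def)
  ultimately obtain w where "w \<in> V - S" "common_neighbour E S w"
    using extension_property_le[OF ext fin \<open>k \<le> card V\<close>] by blast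
  then show False
    by (auto simp: S_def common_neighbour_def insert_commute)
qed

lemma extension_property_not_ETI:
  assumes "simple_graph V E" "extension_property 4 V E" "4 \<le> card V"
  shows "\<not> edge_transmission_irregular V E"
proof
  assume "edge_transmission_irregular V E"
  then have inj: "inj_on (edge_transmission V E) E"
    by (simp add: edge_transmission_irregular_def)
  let ?n = "card V"
  have fin: "finite V" and sub: "E \<subseteq> {e. e \<subseteq> V \<and> card e = 2}"
    using assms(1) by (auto simp: simple_graph_def)
  have trans: "transmission V E v \<in> {?n - 1..2 * (?n - 1)}" if v: "v \<in> V" for v
  proof (rule transmission_bounds[OF fin v])
    fix u assume u: "u \<in> V - {v}"
    have "card {v, u} \<le> 4"
      by (simp add: card_insert_if)
    then obtain w where "w \<in> V - {v, u}" "common_neighbour E {v, u} w"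
      using extension_property_le[OF assms(2) fin assms(3), of "{v, u}"] u v by blast
    then show "graph_dist V E v u \<in> {1..2}"
      using graph_dist_common_neighbour[of v V u w E] u v by auto
  qed
  have "edge_transmission V E ` E \<subseteq> {2 * (?n - 1)..4 * (?n - 1)}"
  proof (rule image_subsetI)
    fix e assume "e \<in> E"
    then obtain u v where uv: "e = {u, v}" "u \<noteq> v" "u \<in> V" "v \<in> V"
      using sub by (auto simp: card_2_iff)
    then show "edge_transmission V E e \<in> {2 * (?n - 1)..4 * (?n - 1)}"
      using trans[of u] trans[of v] by (simp add: edge_transmission_def)
  qed
  then have "card E \<le> card {2 * (?n - 1)..4 * (?n - 1)}"
    by (rule card_inj_on_le[OF inj]) simp
  then have few: "card E < 2 * ?n"
    using assms(3) by simp
  have "?n * 4 \<le> (\<Sum>v\<in>V. card {e \<in> E. v \<in> e})"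
    using sum_bounded_below[of V 4 "\<lambda>v. card {e \<in> E. v \<in> e}"]
      extension_property_min_degree[OF assms] by simp
  then show False
    using few sum_degrees[OF assms(1)] by simp
qed

section \<open>Counting the graphs without the extension property\<close>

text \<open>
  This is the independence of the events \<open>B w \<subseteq> X\<close> for a uniformly random subset \<open>X\<close> of \<open>P\<close> and
  disjoint blocks \<open>B w\<close>. In the induction step \<open>X\<close> splits into its part in the new block, any
  proper subset of that block, and its part in the rest of \<open>P\<close>, which is subject only to the other
  conditions; hence \<open>P\<close> has to vary.
\<close>

lemma card_subsets_avoiding_blocks:
  fixes P :: "'b set" and B :: "'c \<Rightarrow> 'b set"
  assumes "finite W" "finite P" "\<And>w. w \<in> W \<Longrightarrow> B w \<subseteq> P" "\<And>w. w \<in> W \<Longrightarrow> card (B w) = k"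
    and "disjoint_family_on B W"
  shows "real (card {X. X \<subseteq> P \<and> (\<forall>w\<in>W. \<not> B w \<subseteq> X)}) = (1 - 1 / 2 ^ k) ^ card W * 2 ^ card P"
  using assms
proof (induction W arbitrary: P rule: finite_induct)
  case empty
  have "{X. X \<subseteq> P} = Pow P"
    by auto
  then show ?case
    using empty by (simp add: card_Pow)
next
  case (insert w W)
  let ?A = "{X. X \<subseteq> P - B w \<and> (\<forall>v\<in>W. \<not> B v \<subseteq> X)}"
  let ?C = "Pow (B w) - {B w}"
  have finB: "finite (B w)"
    using insert.prems by (meson finite_subset insertI1)
  have disj: "B v \<inter> B w = {}" if "v \<in> W" for v
    using insert.prems(4) insert.hyps that by (auto simp: disjoint_family_on_def)
  have "{X. X \<subseteq> P \<and> (\<forall>v\<in>insert w W. \<not> B v \<subseteq> X)} = (\<lambda>(X, Y). X \<union> Y) ` (?A \<times> ?C)"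
    (is "?L = ?R")
  proof
    show "?L \<subseteq> ?R"
    proof
      fix X assume "X \<in> ?L"
      then have "(X - B w, X \<inter> B w) \<in> ?A \<times> ?C"
        by auto
      moreover have "X = (X - B w) \<union> (X \<inter> B w)"
        by auto
      ultimately show "X \<in> ?R"
        by (metis (no_types, lifting) case_prod_conv image_eqI)
    qed
    have "X \<union> Y \<in> ?L" if "X \<in> ?A" "Y \<in> ?C" for X Y
    proof -
      have "B w \<subseteq> P"
        using insert.prems by simp
      then show ?thesis
        using that disj by blast
    qed
    then show "?R \<subseteq> ?L"
      by (auto simp del: mem_Collect_eq)
  qed
  moreover have "inj_on (\<lambda>(X, Y). X \<union> Y) (?A \<times> ?C)"
    by (rule inj_on_inverseI[of _ "\<lambda>Z. (Z - B w, Z \<inter> B w)"]) auto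
  ultimately have split: "card {X. X \<subseteq> P \<and> (\<forall>v\<in>insert w W. \<not> B v \<subseteq> X)} = card ?A * card ?C"
    by (simp add: card_image card_cartesian_product)
  have A: "real (card ?A) = (1 - 1 / 2 ^ k) ^ card W * 2 ^ card (P - B w)"
  proof (rule insert.IH)
    show "B v \<subseteq> P - B w" if "v \<in> W" for v
      using insert.prems(2)[of v] disj[OF that] that by auto
    show "disjoint_family_on B W"
      using insert.prems(4) by (auto simp: disjoint_family_on_def)
  qed (use insert.prems in auto)
  have C: "real (card ?C) = 2 ^ k - 1"
    using finB insert.prems(3)[of w] by (simp add: card_Pow card_Diff_singleton of_nat_diff)
  have P: "card P = card (P - B w) + k"
    using insert.prems(2,3)[of w] insert.prems(1) finB
      card_mono[of P "B w"] by (simp add: card_Diff_subset)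
  have "real (card {X. X \<subseteq> P \<and> (\<forall>v\<in>insert w W. \<not> B v \<subseteq> X)})
      = ((1 - 1 / 2 ^ k) ^ card W * 2 ^ card (P - B w)) * (2 ^ k - 1)"
    unfolding split of_nat_mult A C ..
  also have "\<dots> = (1 - 1 / 2 ^ k) ^ Suc (card W) * 2 ^ card P"
    unfolding P by (simp add: power_add algebra_simps)
  finally show ?case
    using insert.hyps by simp
qed

lemma card_no_common_neighbour:
  assumes "finite V" "S \<subseteq> V"
  shows "real (card {E \<in> graphs_on V. \<forall>w\<in>V - S. \<not> common_neighbour E S w})
    = (1 - 1 / 2 ^ card S) ^ (card V - card S) * real (card (graphs_on V))"
proof -
  let ?P = "{e. e \<subseteq> V \<and> card e = 2}"
  let ?B = "\<lambda>w. (\<lambda>s. {w, s}) ` S"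
  have "card (?B w) = card S" for w
    by (intro card_image) (auto simp: inj_on_def doubleton_eq_iff)
  moreover have "?B w \<subseteq> ?P" if "w \<in> V - S" for w
    using that assms(2) by (auto simp: card_2_iff)
  moreover have "disjoint_family_on ?B (V - S)"
    by (auto simp: disjoint_family_on_def doubleton_eq_iff)
  ultimately have "real (card {X. X \<subseteq> ?P \<and> (\<forall>w\<in>V - S. \<not> ?B w \<subseteq> X)})
      = (1 - 1 / 2 ^ card S) ^ card (V - S) * 2 ^ card ?P"
    using assms(1) by (intro card_subsets_avoiding_blocks) auto
  moreover have "{E \<in> graphs_on V. \<forall>w\<in>V - S. \<not> common_neighbour E S w}
      = {X. X \<subseteq> ?P \<and> (\<forall>w\<in>V - S. \<not> ?B w \<subseteq> X)}"
    using assms(1)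
    by (auto simp: graphs_on_def simple_graph_def common_neighbour_def image_subset_iff)
  moreover have "card (V - S) = card V - card S"
    using assms by (simp add: card_Diff_subset finite_subset)
  ultimately show ?thesis
    using assms(1) by (simp add: card_graphs_on n_subsets)
qed

lemma card_not_extension_property:
  assumes "finite V"
  shows "real (card {E \<in> graphs_on V. \<not> extension_property k V E})
    \<le> real (card V) ^ k * (1 - 1 / 2 ^ k) ^ (card V - k) * real (card (graphs_on V))"
proof -
  let ?I = "{S. S \<subseteq> V \<and> card S = k}"
  let ?bad = "\<lambda>S. {E \<in> graphs_on V. \<forall>w\<in>V - S. \<not> common_neighbour E S w}"
  have finI: "finite ?I"
    using assms by simp
  have "{E \<in> graphs_on V. \<not> extension_property k V E} = (\<Union>S\<in>?I. ?bad S)"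
    by (auto simp: extension_property_def)
  then have "real (card {E \<in> graphs_on V. \<not> extension_property k V E})
      \<le> (\<Sum>S\<in>?I. real (card (?bad S)))"
    using card_UN_le[OF finI, of ?bad] by (simp flip: of_nat_sum)
  also have "\<dots> = (\<Sum>S\<in>?I. (1 - 1 / 2 ^ k) ^ (card V - k) * real (card (graphs_on V)))"
    using card_no_common_neighbour[OF assms] by (intro sum.cong) auto
  also have "\<dots> = real (card V choose k) * ((1 - 1 / 2 ^ k) ^ (card V - k) * real (card (graphs_on V)))"
    using assms by (simp add: n_subsets)
  also have "\<dots> \<le> real (card V ^ k) * ((1 - 1 / 2 ^ k) ^ (card V - k) * real (card (graphs_on V)))"
  proof (intro mult_right_mono mult_nonneg_nonneg zero_le_power)
    show "real (card V choose k) \<le> real (card V ^ k)"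
      by (cases "k \<le> card V") (simp_all only: of_nat_le_iff binomial_le_pow binomial_eq_0 not_le zero_le)
  qed simp_all
  finally show ?thesis
    by (simp add: mult.assoc)
qed

section \<open>Almost no graph is edge transmission irregular\<close>

theorem theorem3p2:
  "(\<lambda>n::nat. real (card {E \<in> graphs_on {1..n}. edge_transmission_irregular {1..n} E})
             / real (card (graphs_on {1..n}))) \<longlonglongrightarrow> 0"
proof (rule tendsto_sandwich[of "\<lambda>_. 0"])
  \<comment> \<open>\<open>n ^ 4 * (15/16) ^ (n - 4)\<close> without the truncated subtraction; equal to it for \<open>n \<ge> 4\<close>.\<close>
  let ?bound = "\<lambda>n. real n ^ 4 * ((15 / 16) ^ n * (16 / 15) ^ 4)"
  show "?bound \<longlonglongrightarrow> 0"
    by real_asymp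
  show "\<forall>\<^sub>F n in sequentially. real (card {E \<in> graphs_on {1..n}. edge_transmission_irregular {1..n} E})
      / real (card (graphs_on {1..n})) \<le> ?bound n"
    using eventually_ge_at_top[of 4]
  proof eventually_elim
    fix n :: nat assume "4 \<le> n"
    let ?V = "{1..n}"
    have pos: "0 < card (graphs_on ?V)"
      by (simp add: card_graphs_on)
    have "{E \<in> graphs_on ?V. edge_transmission_irregular ?V E}
        \<subseteq> {E \<in> graphs_on ?V. \<not> extension_property 4 ?V E}"
      using extension_property_not_ETI[of ?V] \<open>4 \<le> n\<close> by (auto simp: graphs_on_def)
    moreover have "finite {E \<in> graphs_on ?V. \<not> extension_property 4 ?V E}"
      using card_ge_0_finite[OF pos] by simp
    ultimately have "real (card {E \<in> graphs_on ?V. edge_transmission_irregular ?V E})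
        \<le> real (card {E \<in> graphs_on ?V. \<not> extension_property 4 ?V E})"
      by (simp add: card_mono)
    also have "\<dots> \<le> real n ^ 4 * (15 / 16) ^ (n - 4) * real (card (graphs_on ?V))"
      using card_not_extension_property[of ?V 4] by simp
    also have "(15 / 16 :: real) ^ (n - 4) = (15 / 16) ^ n * (16 / 15) ^ 4"
      using \<open>4 \<le> n\<close> by (simp add: power_diff power_divide)
    finally show "real (card {E \<in> graphs_on ?V. edge_transmission_irregular ?V E})
        / real (card (graphs_on ?V)) \<le> ?bound n"
      using pos by (simp add: pos_divide_le_eq mult.assoc)
  qed
qed simp_all

end
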